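(* Let $\mathcal{I}$ be a finite set of closed non-degenerate intervals on the real line and let $G$ be its directional intersection graph. Then the Greedy Algorithm applied to $\mathcal{I}$ computes a proper coloring of $G$ using exactly $\chi(G)$ colors, where $\chi(G)$ is the minimum number of colors in any proper coloring of $G$.
   Context: A mixed graph $G=(V,E,A)$ has vertex set $V$, a set $E$ of undirected edges and a set $A$ of directed arcs, with at most one edge or arc between any two vertices. A proper coloring of a mixed graph assigns a positive integer $c(v)$ to each vertex so that $c(u)\neq c(v)$ for every edge $\{u,v\}$ and $c(u)<c(v)$ for every arc $(u,v)$; $\chi(G)$ is the smallest number of colors (i.e., smallest possible maximum color) in a proper coloring. For a set $\mathcal{I}$ of closed non-degenerate intervals, the directional intersection graph of $\mathcal{I}$ has vertex set $\mathcal{I}$ and, for any two intervals $u=[l_u,r_u]$, $v=[l_v,r_v]$ with $l_u\le l_v$: they are non-adjacent iff $r_u<l_v$; there is an arc $(u,v)$ iff $l_u<l_v\le r_u<r_v$ ("$u$ overlaps $v$"); there is an edge $\{u,v\}$ iff $r_v\le r_u$ ("$u$ contains $v$"). Greedy Algorithm: iterate over the intervals in increasing order of their left endpoints; assign to each interval $v$ the smallest available color $c(v)$, where a positive integer $k$ is available for $v$ if for every already colored interval $u$: $k\neq c(u)$ if $u$ contains $v$, and $k>c(u)$ if $u$ overlaps $v$.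
   Formalization: Intervals with the same left endpoint are processed in decreasing order of right endpoint (the containing interval first); with arbitrary tie-breaking the claim fails, e.g. [0,1] processed before [0,3] gives both color 1 although they are adjacent. *)

theory Defs
  imports Complex_Main "HOL-Library.Interval"
begin

record 'a mixed_graph =
  verts :: "'a set"
  edges :: "'a set set"
  arcs  :: "('a \<times> 'a) set"

definition wf_mixed_graph :: "'a mixed_graph \<Rightarrow> bool" where
  "wf_mixed_graph G \<longleftrightarrow>
     (\<forall>e \<in> edges G. \<exists>u v. u \<in> verts G \<and> v \<in> verts G \<and> u \<noteq> v \<and> e = {u, v}) \<and>
     (\<forall>(u, v) \<in> arcs G. u \<in> verts G \<and> v \<in> verts G \<and> u \<noteq> v \<and>
        (v, u) \<notin> arcs G \<and> {u, v} \<notin> edges G)"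

definition proper_coloring :: "'a mixed_graph \<Rightarrow> ('a \<Rightarrow> nat) \<Rightarrow> bool" where
  "proper_coloring G c \<longleftrightarrow>
     (\<forall>v \<in> verts G. 0 < c v) \<and>
     (\<forall>u v. {u, v} \<in> edges G \<longrightarrow> c u \<noteq> c v) \<and>
     (\<forall>u v. (u, v) \<in> arcs G \<longrightarrow> c u < c v)"

(* The number of colors is the maximum color; inserting 0 only covers the empty graph. *)
definition num_colors :: "'a mixed_graph \<Rightarrow> ('a \<Rightarrow> nat) \<Rightarrow> nat" where
  "num_colors G c = Max (insert 0 (c ` verts G))"

(* Only meaningful if G is finite and admits a proper coloring. *)
definition chromatic_number :: "'a mixed_graph \<Rightarrow> nat" where
  "chromatic_number G = (LEAST k. \<exists>c. proper_coloring G c \<and> num_colors G c = k)"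

(* The type real interval consists of the closed intervals with lower u \<le> upper u. *)
definition nondegenerate :: "real interval \<Rightarrow> bool" where
  "nondegenerate u \<longleftrightarrow> lower u < upper u"

definition overlaps_iv :: "real interval \<Rightarrow> real interval \<Rightarrow> bool" where
  "overlaps_iv u v \<longleftrightarrow> lower u < lower v \<and> lower v \<le> upper u \<and> upper u < upper v"

definition contains_iv :: "real interval \<Rightarrow> real interval \<Rightarrow> bool" where
  "contains_iv u v \<longleftrightarrow> lower u \<le> lower v \<and> upper v \<le> upper u"

definition directional_intersection_graph :: "real interval set \<Rightarrow> real interval mixed_graph" where
  "directional_intersection_graph I =
     \<lparr> verts = I,
       edges = {{u, v} | u v. u \<in> I \<and> v \<in> I \<and> u \<noteq> v \<and> contains_iv u v},
       arcs = {(u, v). u \<in> I \<and> v \<in> I \<and> overlaps_iv u v} \<rparr>"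

lemma contains_iv_antisym: "contains_iv u v \<Longrightarrow> contains_iv v u \<Longrightarrow> u = v"
  by (auto simp: contains_iv_def interval_eq_iff)

lemma wf_directional_intersection_graph: "wf_mixed_graph (directional_intersection_graph I)"
  unfolding wf_mixed_graph_def directional_intersection_graph_def
  by (fastforce simp: overlaps_iv_def contains_iv_def doubleton_eq_iff)

(* Coloring state: the partial map from the already colored intervals to their colors. *)
definition available :: "(real interval \<rightharpoonup> nat) \<Rightarrow> real interval \<Rightarrow> nat \<Rightarrow> bool" where
  "available m v k \<longleftrightarrow> 0 < k \<and>
     (\<forall>u j. m u = Some j \<longrightarrow>
        (contains_iv u v \<longrightarrow> k \<noteq> j) \<and> (overlaps_iv u v \<longrightarrow> j < k))"

definition greedy_step :: "real interval \<Rightarrow> (real interval \<rightharpoonup> nat) \<Rightarrow> (real interval \<rightharpoonup> nat)" where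
  "greedy_step v m = m(v \<mapsto> (LEAST k. available m v k))"

(* Increasing left endpoints. Intervals with a common left endpoint are ordered so that an interval
   precedes the ones it contains: otherwise the availability test, which only looks for colored
   intervals containing the current one, would miss an edge. *)
definition before :: "real interval \<Rightarrow> real interval \<Rightarrow> bool" where
  "before u v \<longleftrightarrow> lower u < lower v \<or> lower u = lower v \<and> upper v \<le> upper u"

lemma directional_intersection_graph_cases:
  assumes "u \<in> I" "v \<in> I" "u \<noteq> v" "before u v"
  shows "{u, v} \<in> edges (directional_intersection_graph I) \<longleftrightarrow> upper v \<le> upper u"
    and "{u, v} \<notin> edges (directional_intersection_graph I) \<and>
         (u, v) \<notin> arcs (directional_intersection_graph I) \<and>
         (v, u) \<notin> arcs (directional_intersection_graph I) \<longleftrightarrow> upper u < lower v"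
proof -
  have edge: "{u, v} \<in> edges (directional_intersection_graph I) \<longleftrightarrow> contains_iv u v \<or> contains_iv v u"
    using assms(1-3) by (auto simp: directional_intersection_graph_def doubleton_eq_iff)
  show "{u, v} \<in> edges (directional_intersection_graph I) \<longleftrightarrow> upper v \<le> upper u"
    using assms(4) unfolding edge contains_iv_def before_def by auto
  have "\<not> (upper u < lower v \<and> upper v \<le> upper u)"
    using lower_le_upper[of v] by linarith
  then show "{u, v} \<notin> edges (directional_intersection_graph I) \<and>
        (u, v) \<notin> arcs (directional_intersection_graph I) \<and>
        (v, u) \<notin> arcs (directional_intersection_graph I) \<longleftrightarrow> upper u < lower v"
    using assms unfolding edge
    by (auto simp: directional_intersection_graph_def contains_iv_def before_def overlaps_iv_def)
qed

definition greedy_order :: "real interval set \<Rightarrow> real interval list \<Rightarrow> bool" where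
  "greedy_order I us \<longleftrightarrow> set us = I \<and> distinct us \<and> sorted_wrt before us"

lemma ex1_greedy_order:
  assumes "finite I"
  shows "\<exists>!us. greedy_order I us"
proof (rule ex_ex1I)
  show "\<exists>us. greedy_order I us"
    using assms
  proof induction
    case empty
    then show ?case by (simp add: greedy_order_def)
  next
    case (insert x I)
    then obtain us where us: "set us = I" "distinct us" "sorted_wrt before us"
      by (auto simp: greedy_order_def)
    let ?us = "filter (\<lambda>u. before u x) us @ x # filter (\<lambda>u. \<not> before u x) us"
    have "sorted_wrt before ?us"
      using us(3) by (auto simp: sorted_wrt_append sorted_wrt_filter before_def)
    moreover have "set ?us = insert x I" "distinct ?us"
      using us insert.hyps by auto
    ultimately show ?case
      unfolding greedy_order_def by blast
  qed
next
  have antisym: "u = v" if "before u v" "before v u" for u v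
    using that by (auto simp: before_def interval_eq_iff)
  have "us = vs" if "sorted_wrt before us" "sorted_wrt before vs" "distinct us" "distinct vs"
      "set us = set vs" for us vs
    using that
  proof (induction us arbitrary: vs)
    case Nil
    then show ?case by simp
  next
    case (Cons u us)
    then obtain v vs' where vs: "vs = v # vs'" by (cases vs) auto
    have "u = v"
      using Cons.prems antisym unfolding vs by (metis list.set_intros(1) set_ConsD sorted_wrt.simps(2))
    moreover have "set us = set vs'"
      using Cons.prems \<open>u = v\<close> unfolding vs by auto
    ultimately show ?case
      using Cons.IH[of vs'] Cons.prems unfolding vs by auto
  qed
  then show "us = vs" if "greedy_order I us" "greedy_order I vs" for us vs
    using that by (simp add: greedy_order_def)
qed

definition greedy_coloring :: "real interval set \<Rightarrow> real interval \<Rightarrow> nat" where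
  "greedy_coloring I v = the (fold greedy_step (THE us. greedy_order I us) Map.empty v)"

end

theory Submission
  imports Defs
begin

text \<open>
  Fix any proper coloring \<open>c\<close> and let the greedy algorithm give an interval \<open>v\<close> the color \<open>g v\<close>. Let \<open>p\<close>
  be the largest greedy color of an interval \<open>u\<close> overlapping \<open>v\<close>. The colors strictly between \<open>p\<close> and
  \<open>g v\<close> can only be blocked by intervals containing \<open>v\<close>. Repeating this from \<open>u\<close> gives a chain of arcs
  ending in \<open>v\<close>, together with intervals containing the members of the chain, on which \<open>g\<close> takes each of
  the values \<open>1, ..., g v\<close>. Any two of the collected intervals either intersect or are joined by a
  directed path, so \<open>c\<close> is injective on them and needs at least \<open>g v\<close> colors.
\<close>

section \<open>Directed paths of overlapping intervals\<close>

definition overlap_rel :: "real interval set \<Rightarrow> real interval rel" where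
  "overlap_rel I = {(u, v). u \<in> I \<and> v \<in> I \<and> overlaps_iv u v}"

lemma proper_coloring_directional_iff:
  "proper_coloring (directional_intersection_graph I) c \<longleftrightarrow>
     (\<forall>v \<in> I. 0 < c v) \<and>
     (\<forall>u \<in> I. \<forall>v \<in> I. u \<noteq> v \<longrightarrow> contains_iv u v \<longrightarrow> c u \<noteq> c v) \<and>
     (\<forall>(u, v) \<in> overlap_rel I. c u < c v)"
  unfolding proper_coloring_def directional_intersection_graph_def overlap_rel_def
  by (fastforce simp: doubleton_eq_iff)

lemma contains_iv_refl [simp]: "contains_iv u u"
  by (simp add: contains_iv_def)

lemma overlap_path_mono:
  assumes "(x, v) \<in> (overlap_rel I)\<^sup>*"
  shows "upper x \<le> upper v"
  using assms by induction (auto simp: overlap_rel_def overlaps_iv_def)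

text \<open>As long as the path stays below \<open>upper w\<close>, its members remain inside
  \<open>w\<close>. The first member reaching beyond \<open>upper w\<close> is therefore overlapped
  by \<open>w\<close>.\<close>

lemma overlap_path_enlarge_source:
  assumes "(x, v) \<in> (overlap_rel I)\<^sup>*" "contains_iv w x" "w \<in> I" "upper w < upper v"
  shows "\<exists>a. (w, a) \<in> overlap_rel I \<and> (a, v) \<in> (overlap_rel I)\<^sup>*"
  using assms
proof (induction rule: converse_rtrancl_induct)
  case base
  then show ?case by (simp add: contains_iv_def)
next
  case (step x y)
  show ?case
  proof (cases "upper y \<le> upper w")
    case True
    with step show ?thesis
      by (auto simp: contains_iv_def overlap_rel_def overlaps_iv_def)
  next
    case False
    with step have "(w, y) \<in> overlap_rel I"
      by (auto simp: contains_iv_def overlap_rel_def overlaps_iv_def)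
    with step.hyps show ?thesis by blast
  qed
qed

text \<open>The mirror image: going back from \<open>v\<close>, members stay inside \<open>u\<close>
  until one starts left of \<open>lower u\<close>, and that one overlaps \<open>u\<close>.\<close>

lemma overlap_path_enlarge_target:
  assumes "(x, v) \<in> (overlap_rel I)\<^sup>*" "contains_iv u v" "u \<in> I" "lower x < lower u"
  shows "\<exists>b. (x, b) \<in> (overlap_rel I)\<^sup>* \<and> (b, u) \<in> overlap_rel I"
  using assms
proof (induction rule: rtrancl_induct)
  case base
  then show ?case by (simp add: contains_iv_def)
next
  case (step y z)
  show ?case
  proof (cases "lower u \<le> lower y")
    case True
    with step show ?thesis
      by (auto simp: contains_iv_def overlap_rel_def overlaps_iv_def)
  next
    case False
    with step have "(y, u) \<in> overlap_rel I"
      by (auto simp: contains_iv_def overlap_rel_def overlaps_iv_def)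
    with step.hyps show ?thesis by blast
  qed
qed

lemma proper_coloring_overlap_path:
  assumes "proper_coloring (directional_intersection_graph I) c" "(x, v) \<in> (overlap_rel I)\<^sup>+"
  shows "c x < c v"
  using assms(2)
  by induction (use assms(1) in \<open>fastforce simp: proper_coloring_directional_iff\<close>)+

text \<open>Right endpoints do not decrease along the path, so \<open>w\<close> cannot lie entirely
  to the right of \<open>u\<close>. If the two intersect, they are adjacent; otherwise
  \<open>w\<close> lies to the left of \<open>u\<close>, and enlarging both ends of the path joins
  \<open>w\<close> to \<open>u\<close> by arcs.\<close>

lemma containers_of_overlap_path_distinct:
  assumes c: "proper_coloring (directional_intersection_graph I) c"
    and path: "(x, v) \<in> (overlap_rel I)\<^sup>*"
    and w: "w \<in> I" "contains_iv w x" and u: "u \<in> I" "contains_iv u v" and "u \<noteq> w"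
  shows "c u \<noteq> c w"
proof -
  have wu: "lower w \<le> upper u"
    using overlap_path_mono[OF path] w u lower_le_upper[of x] unfolding contains_iv_def by linarith
  show ?thesis
  proof (cases "upper w < lower u")
    case True
    then have "upper w < upper v"
      using u lower_le_upper[of v] unfolding contains_iv_def by linarith
    then obtain a where a: "(w, a) \<in> overlap_rel I" "(a, v) \<in> (overlap_rel I)\<^sup>*"
      using overlap_path_enlarge_source path w by blast
    \<comment> \<open>\<open>a\<close> starts inside \<open>w\<close>, hence left of
      \<open>u\<close>, so the target can be enlarged on the rest of the path.\<close>
    have "lower a < lower u"
      using a(1) True by (auto simp: overlap_rel_def overlaps_iv_def)
    then obtain b where "(a, b) \<in> (overlap_rel I)\<^sup>*" "(b, u) \<in> overlap_rel I"
      using overlap_path_enlarge_target a(2) u by blast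
    with a(1) have "(w, u) \<in> (overlap_rel I)\<^sup>+"
      by (meson rtrancl_into_trancl1 rtrancl_into_trancl2 trancl_into_rtrancl)
    then show ?thesis
      using proper_coloring_overlap_path[OF c] by fastforce
  next
    case False
    with wu have "contains_iv u w \<or> contains_iv w u \<or> overlaps_iv u w \<or> overlaps_iv w u"
      by (auto simp: contains_iv_def overlaps_iv_def)
    then show ?thesis
      using c w(1) u(1) \<open>u \<noteq> w\<close>
      by (fastforce simp: proper_coloring_directional_iff overlap_rel_def)
  qed
qed

section \<open>The greedy coloring as a solution of a fixed-point equation\<close>

text \<open>This is \<open>available\<close> for a total coloring of all of \<open>I\<close>. The
  condition \<open>u \<noteq> v\<close> keeps \<open>v\<close>, which contains itself, from blocking
  its own color.\<close>

definition unblocked ::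
    "real interval set \<Rightarrow> (real interval \<Rightarrow> nat) \<Rightarrow> real interval \<Rightarrow> nat \<Rightarrow> bool" where
  "unblocked I g v k \<longleftrightarrow> 0 < k \<and>
     (\<forall>u \<in> I. u \<noteq> v \<longrightarrow> (contains_iv u v \<longrightarrow> k \<noteq> g u) \<and> (overlaps_iv u v \<longrightarrow> g u < k))"

lemma unblocked_cong:
  assumes "\<And>u. u \<in> I \<Longrightarrow> g u = h u"
  shows "unblocked I g = unblocked I h"
  using assms by (simp add: unblocked_def fun_eq_iff cong: ball_cong)

lemma unblocked_insert_later:
  assumes "before v x"
  shows "unblocked (insert x I) g v = unblocked I g v"
proof -
  have "\<not> overlaps_iv x v" "contains_iv x v \<Longrightarrow> x = v"
    using assms by (auto simp: before_def contains_iv_def overlaps_iv_def interval_eq_iff)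
  then show ?thesis
    by (auto simp: unblocked_def fun_eq_iff)
qed

text \<open>Later intervals neither overlap nor contain earlier ones, so each color remains the
  least unblocked one with respect to the final coloring. This lets the order of insertion be
  forgotten.\<close>

lemma fold_greedy_step:
  assumes "distinct us" "sorted_wrt before us"
  defines "m \<equiv> fold greedy_step us Map.empty"
  shows "dom m = set us \<and>
    (\<forall>v \<in> set us. the (m v) = (LEAST k. unblocked (set us) (\<lambda>u. the (m u)) v k))"
  using assms(1,2) unfolding m_def
proof (induction us rule: rev_induct)
  case Nil
  then show ?case by simp
next
  case (snoc x us)
  define m where "m = fold greedy_step us Map.empty"
  define m' where "m' = fold greedy_step (us @ [x]) Map.empty"
  have x: "x \<notin> set us" and bef: "\<And>v. v \<in> set us \<Longrightarrow> before v x"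
    using snoc.prems by (auto simp: sorted_wrt_append)
  have dom: "dom m = set us"
    and IH: "\<And>v. v \<in> set us \<Longrightarrow> the (m v) = (LEAST k. unblocked (set us) (\<lambda>u. the (m u)) v k)"
    using snoc by (auto simp: sorted_wrt_append m_def)
  have m': "m' = m(x \<mapsto> (LEAST k. available m x k))"
    by (simp add: m'_def m_def greedy_step_def)
  have agree: "unblocked (set us) (\<lambda>u. the (m' u)) = unblocked (set us) (\<lambda>u. the (m u))"
    using x by (intro unblocked_cong) (auto simp: m')
  have "m u = Some j \<longleftrightarrow> u \<in> set us \<and> j = the (m u)" for u j
    using dom by force
  then have "available m x = unblocked (set us) (\<lambda>u. the (m u)) x"
    using x by (auto simp: available_def unblocked_def fun_eq_iff)
  \<comment> \<open>The case \<open>v = x\<close> is covered as well, because \<open>before\<close>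
    is reflexive.\<close>
  moreover have "unblocked (set (us @ [x])) (\<lambda>u. the (m' u)) v
      = unblocked (set us) (\<lambda>u. the (m u)) v" if "v \<in> insert x (set us)" for v
    using unblocked_insert_later[of v x "set us"] bef that agree by (auto simp: before_def)
  ultimately have "the (m' v) = (LEAST k. unblocked (set (us @ [x])) (\<lambda>u. the (m' u)) v k)"
    if "v \<in> set (us @ [x])" for v
    using that IH x by (auto simp: m')
  moreover have "dom m' = set (us @ [x])"
    using dom by (auto simp: m')
  ultimately show ?case
    unfolding m'_def by blast
qed

lemma greedy_coloring_eq_Least:
  assumes "finite I" "v \<in> I"
  shows "greedy_coloring I v = (LEAST k. unblocked I (greedy_coloring I) v k)"
proof -
  define us where "us = (THE us. greedy_order I us)"
  have "greedy_order I us"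
    unfolding us_def using ex1_greedy_order[OF assms(1)] by (rule theI')
  then have "set us = I" "distinct us" "sorted_wrt before us"
    by (simp_all add: greedy_order_def)
  moreover have "greedy_coloring I = (\<lambda>u. the (fold greedy_step us Map.empty u))"
    by (simp add: greedy_coloring_def us_def fun_eq_iff)
  ultimately show ?thesis
    using fold_greedy_step[of us] assms(2) by simp
qed

lemma greedy_coloring_unblocked:
  assumes "finite I" "v \<in> I"
  shows "unblocked I (greedy_coloring I) v (greedy_coloring I v)"
proof -
  \<comment> \<open>A color above all those in use is never blocked, so the least unblocked color
    exists.\<close>
  let ?k = "Suc (Max (insert 0 (greedy_coloring I ` I)))"
  have "greedy_coloring I u < ?k" if "u \<in> I" for u
    using assms(1) that by (simp add: less_Suc_eq_le)
  then have "unblocked I (greedy_coloring I) v ?k"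
    unfolding unblocked_def by (metis less_irrefl zero_less_Suc)
  then show ?thesis
    unfolding greedy_coloring_eq_Least[OF assms] by (rule LeastI)
qed

lemma greedy_coloring_blocked_below:
  assumes "finite I" "v \<in> I" "0 < k" "k < greedy_coloring I v"
  obtains u where "u \<in> I"
    "contains_iv u v \<and> greedy_coloring I u = k \<or> overlaps_iv u v \<and> k \<le> greedy_coloring I u"
proof -
  have "\<not> unblocked I (greedy_coloring I) v k"
    using assms(4) not_less_Least unfolding greedy_coloring_eq_Least[OF assms(1,2)] by blast
  then show thesis
    using that \<open>0 < k\<close> by (force simp: unblocked_def)
qed

lemma proper_greedy_coloring:
  assumes "finite I"
  shows "proper_coloring (directional_intersection_graph I) (greedy_coloring I)"
  using greedy_coloring_unblocked[OF assms]
  unfolding proper_coloring_directional_iff overlap_rel_def unblocked_def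
  by (fastforce simp: overlaps_iv_def)

section \<open>The lower bound for an arbitrary proper coloring\<close>

text \<open>The last conjunct is the invariant that makes the induction work: it separates the
  containers of \<open>v\<close>, added in each step, from all intervals collected before.\<close>

lemma greedy_witness_set:
  assumes fin: "finite I" and c: "proper_coloring (directional_intersection_graph I) c"
    and "v \<in> I"
  shows "\<exists>S \<subseteq> I. greedy_coloring I ` S = {1..greedy_coloring I v} \<and> inj_on c S \<and>
    (\<forall>w \<in> S. \<exists>x. contains_iv w x \<and> (x, v) \<in> (overlap_rel I)\<^sup>*)"
  using \<open>v \<in> I\<close>
proof (induction "greedy_coloring I v" arbitrary: v rule: less_induct)
  case less
  let ?g = "greedy_coloring I"
  \<comment> \<open>The default 0 covers the case that nothing overlaps \<open>v\<close>; then
    \<open>S\<close> is empty.\<close>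
  define P where "P = insert 0 (?g ` {u \<in> I. overlaps_iv u v})"
  define p where "p = Max P"
  have "finite P" using fin by (simp add: P_def)
  then have "p \<in> P" unfolding p_def by (rule Max_in) (simp add: P_def)
  have p_max: "?g u \<le> p" if "u \<in> I" "overlaps_iv u v" for u
    using \<open>finite P\<close> that by (simp add: p_def P_def)
  have pos: "0 < ?g v"
    using greedy_coloring_unblocked[OF fin less.prems] by (simp add: unblocked_def)
  have arc_less: "?g u < ?g v" if "u \<in> I" "overlaps_iv u v" for u
    using proper_greedy_coloring[OF fin] that less.prems
    by (auto simp: proper_coloring_directional_iff overlap_rel_def)
  have "p < ?g v"
    using \<open>p \<in> P\<close> pos arc_less by (auto simp: P_def)
  obtain S where S: "S \<subseteq> I" "?g ` S = {1..p}" "inj_on c S"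
    and S_path: "\<forall>w \<in> S. \<exists>x. contains_iv w x \<and> (x, v) \<in> (overlap_rel I)\<^sup>*"
  proof (cases "p = 0")
    case True
    then show thesis using that[of "{}"] by simp
  next
    case False
    then obtain u where u: "u \<in> I" "overlaps_iv u v" "?g u = p"
      using \<open>p \<in> P\<close> by (auto simp: P_def)
    then have "(u, v) \<in> overlap_rel I"
      using less.prems by (simp add: overlap_rel_def)
    \<comment> \<open>The set obtained for \<open>u\<close> serves for \<open>v\<close>, as every
      path to \<open>u\<close> extends by the arc to \<open>v\<close>.\<close>
    then show thesis
      using less.hyps[OF _ u(1)] u(3) \<open>p < ?g v\<close> that by (metis rtrancl.rtrancl_into_rtrancl)
  qed
  define T where "T = {w \<in> I. contains_iv w v \<and> ?g w \<in> {p<..?g v}}"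
  have "{p<..?g v} \<subseteq> ?g ` T"
  proof
    fix k assume k: "k \<in> {p<..?g v}"
    show "k \<in> ?g ` T"
    proof (cases "k = ?g v")
      case True
      with k less.prems show ?thesis by (auto simp: T_def)
    next
      case False
      with k have "0 < k" "k < ?g v" by auto
      then obtain u where "u \<in> I" "contains_iv u v \<and> ?g u = k \<or> overlaps_iv u v \<and> k \<le> ?g u"
        using greedy_coloring_blocked_below[OF fin less.prems] by blast
      \<comment> \<open>An overlapping \<open>u\<close> would give \<open>k \<le> p\<close>, so the
        blocking interval contains \<open>v\<close>.\<close>
      with p_max[of u] k show ?thesis by (force simp: T_def)
    qed
  qed
  then have "?g ` T = {p<..?g v}" by (auto simp: T_def)
  with S(2) \<open>p < ?g v\<close> have img: "?g ` (S \<union> T) = {1..?g v}"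
    by (auto simp: image_Un)
  have T_path: "\<forall>w \<in> T. \<exists>x. contains_iv w x \<and> (x, v) \<in> (overlap_rel I)\<^sup>*"
    by (auto simp: T_def)
  have "c u \<noteq> c w" if "u \<in> T" "w \<in> S \<union> T" "u \<noteq> w" for u w
  proof -
    obtain x where "contains_iv w x" "(x, v) \<in> (overlap_rel I)\<^sup>*"
      using \<open>w \<in> S \<union> T\<close> S_path T_path by blast
    then show ?thesis
      using containers_of_overlap_path_distinct[OF c, of x v w u] that S(1) by (auto simp: T_def)
  qed
  with S(3) have "inj_on c (S \<union> T)"
    unfolding inj_on_def by (metis Un_iff)
  have "T \<subseteq> I" by (simp add: T_def)
  with S(1) have "S \<union> T \<subseteq> I" by (rule Un_least)
  moreover have "\<forall>w \<in> S \<union> T. \<exists>x. contains_iv w x \<and> (x, v) \<in> (overlap_rel I)\<^sup>*"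
    using S_path T_path by (simp only: ball_Un)
  ultimately show ?case
    using img \<open>inj_on c (S \<union> T)\<close> by (intro exI[of _ "S \<union> T"] conjI)
qed

text \<open>Pigeonhole: the witness set has at least as many members as the greedy color of
  \<open>v\<close>, and \<open>c\<close> maps it injectively into the colors from 1 to
  \<open>?n\<close>.\<close>

lemma greedy_coloring_le_num_colors:
  assumes fin: "finite I" and c: "proper_coloring (directional_intersection_graph I) c"
    and "v \<in> I"
  shows "greedy_coloring I v \<le> num_colors (directional_intersection_graph I) c"
proof -
  let ?n = "num_colors (directional_intersection_graph I) c"
  obtain S where S: "S \<subseteq> I" "greedy_coloring I ` S = {1..greedy_coloring I v}" "inj_on c S"
    using greedy_witness_set[OF assms] by blast
  have "c w \<in> {1..?n}" if "w \<in> I" for w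
  proof -
    have "0 < c w" using c that by (simp add: proper_coloring_directional_iff)
    with fin that show ?thesis
      by (simp add: num_colors_def directional_intersection_graph_def)
  qed
  with S(1) have "c ` S \<subseteq> {1..?n}" by blast
  have "finite S" using S(1) fin finite_subset by blast
  have "greedy_coloring I v = card (greedy_coloring I ` S)" using S(2) by simp
  also have "\<dots> \<le> card S" using \<open>finite S\<close> by (rule card_image_le)
  also have "\<dots> = card (c ` S)" using S(3) by (simp add: card_image)
  also have "\<dots> \<le> card {1..?n}" using \<open>c ` S \<subseteq> _\<close> by (intro card_mono) auto
  finally show ?thesis by simp
qed

theorem theorem1:
  fixes I :: "real interval set"
  assumes "finite I" and "\<forall>u \<in> I. nondegenerate u"
  shows "proper_coloring (directional_intersection_graph I) (greedy_coloring I) \<and>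
         num_colors (directional_intersection_graph I) (greedy_coloring I) =
           chromatic_number (directional_intersection_graph I)"
proof -
  let ?G = "directional_intersection_graph I"
  have "num_colors ?G (greedy_coloring I) \<le> num_colors ?G c" if "proper_coloring ?G c" for c
    using greedy_coloring_le_num_colors[OF assms(1) that] assms(1)
    by (subst num_colors_def) (auto simp: directional_intersection_graph_def)
  then have "chromatic_number ?G = num_colors ?G (greedy_coloring I)"
    unfolding chromatic_number_def
    using proper_greedy_coloring[OF assms(1)] by (intro Least_equality) auto
  then show ?thesis
    using proper_greedy_coloring[OF assms(1)] by simp
qed

end
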